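(* Let $\mathcal Z$ be a measurable set, $c:\mathcal Z\times\mathcal Z\to\mathbb R_+$ a transportation cost function, $\nu\in\mathcal P(\mathcal Z)$ a reference probability measure, $\mathbb P\in\mathcal P(\mathcal Z)$, and fix a radius $\rho\ge 0$. Let $\mathbb B_{\rho}(\mathbb P)$ and $\mathbb B_{\rho,\epsilon}(\mathbb P)$ denote the optimal transport and Sinkhorn ambiguity sets (defined in the context). Then: 1. $\mathbb B_{\rho,\epsilon}(\mathbb P)\subseteq\mathbb B_{\rho}(\mathbb P)$ for all $\epsilon\ge 0$; 2. $\mathbb B_{\rho,\epsilon_2}(\mathbb P)\subseteq\mathbb B_{\rho,\epsilon_1}(\mathbb P)$ for all $\epsilon_1,\epsilon_2$ with $0\le\epsilon_1\le\epsilon_2$; 3. if $\int_{\mathcal Z\times\mathcal Z}c(x,y)\,d\mathbb P(x)\,d\nu(y)\le\rho$, then $\mathbb B_{\rho,\infty}(\mathbb P)$ is the singleton $\{\nu\}$; otherwise, it is the empty set.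
   Context: $\mathcal P(\mathcal Z)$ is the set of probability distributions supported on $\mathcal Z$. A transportation cost function is a lower semicontinuous function $c:\mathcal Z\times\mathcal Z\to\mathbb R_+$ with $c(x,y)=0$ if and only if $x=y$. $\Gamma(\mathbb P,\mathbb Q)$ is the set of couplings of $\mathbb P$ and $\mathbb Q$, i.e. joint probability distributions with marginals $\mathbb P$ and $\mathbb Q$. Optimal transport discrepancy: $OT_c(\mathbb P,\mathbb Q)=\inf_{\gamma\in\Gamma(\mathbb P,\mathbb Q)}\mathbb E_{(x,y)\sim\gamma}[c(x,y)]$, and $\mathbb B_\rho(\mathbb P)=\{\mathbb Q\in\mathcal P(\mathcal Z): OT_c(\mathbb P,\mathbb Q)\le\rho\}$. Sinkhorn discrepancy (reference measures $\mathbb P$ for the first marginal and $\nu$ for the second): $W_c^\epsilon(\mathbb P,\mathbb Q)=\inf_{\gamma\in\Gamma(\mathbb P,\mathbb Q)}\{\mathbb E_\gamma[c(x,y)]+\epsilon H(\gamma|\mathbb P\times\nu)\}$, where $H(\gamma|\mathbb P\times\nu)=\mathbb E_\gamma[\log\frac{d\gamma(x,y)}{d\mathbb P(x)\,d\nu(y)}]$ is the Kullback–Leibler divergence ($+\infty$ if $\gamma\not\ll\mathbb P\times\nu$, in particular whenever $\mathbb Q\not\ll\nu$), and $\mathbb B_{\rho,\epsilon}(\mathbb P)=\{\mathbb Q\in\mathcal P(\mathcal Z): W_c^\epsilon(\mathbb P,\mathbb Q)\le\rho\}$. Conventions: $W_c^0=OT_c$ (i.e. $0\cdot\infty=0$ in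 the regularization term); for $\epsilon=\infty$, the term $\infty\cdot H(\gamma|\mathbb P\times\nu)$ is $0$ if $H(\gamma|\mathbb P\times\nu)=0$ and $+\infty$ otherwise. *)

theory Defs
  imports "HOL-Probability.Probability"
begin

definition probs_on :: "'a::topological_space set \<Rightarrow> 'a measure set" where
  "probs_on Z = space (prob_algebra (restrict_space borel Z))"

lemma mem_probs_on_iff:
  "P \<in> probs_on Z \<longleftrightarrow> sets P = sets (restrict_space borel Z) \<and> prob_space P"
  by (simp add: probs_on_def space_prob_algebra)

definition lower_semicontinuous_on :: "'a::topological_space set \<Rightarrow> ('a \<Rightarrow> real) \<Rightarrow> bool" where
  "lower_semicontinuous_on S f \<longleftrightarrow>
     (\<forall>x\<in>S. \<forall>a. a < f x \<longrightarrow> (\<forall>\<^sub>F y in at x within S. a < f y))"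

definition transport_cost :: "'a::topological_space set \<Rightarrow> ('a \<times> 'a \<Rightarrow> real) \<Rightarrow> bool" where
  "transport_cost Z c \<longleftrightarrow>
     lower_semicontinuous_on (Z \<times> Z) c \<and>
     (\<forall>x\<in>Z. \<forall>y\<in>Z. 0 \<le> c (x, y)) \<and>
     (\<forall>x\<in>Z. \<forall>y\<in>Z. c (x, y) = 0 \<longleftrightarrow> x = y)"

definition couplings :: "'a measure \<Rightarrow> 'b measure \<Rightarrow> ('a \<times> 'b) measure set" where
  "couplings P Q =
     {\<gamma>. prob_space \<gamma> \<and> sets \<gamma> = sets (P \<Otimes>\<^sub>M Q) \<and> distr \<gamma> P fst = P \<and> distr \<gamma> Q snd = Q}"

definition expected_cost :: "('a \<Rightarrow> real) \<Rightarrow> 'a measure \<Rightarrow> ereal" where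
  "expected_cost c \<gamma> = enn2ereal (\<integral>\<^sup>+ z. ennreal (c z) \<partial>\<gamma>)"

definition OT :: "('a \<times> 'a \<Rightarrow> real) \<Rightarrow> 'a measure \<Rightarrow> 'a measure \<Rightarrow> ereal" where
  "OT c P Q = (INF \<gamma> \<in> couplings P Q. expected_cost c \<gamma>)"

text \<open>
  \<^const>\<open>KL_divergence\<close> is a real-valued Bochner integral, hence $0$ when the log-density is not
  integrable.  For a probability measure \<open>N\<close> dominated by a probability measure \<open>M\<close>, the negative
  part of the log-density is always \<open>N\<close>-integrable (as $t \log t \ge -1/e$), so that in
  the non-integrable case the extended integral is $+\infty$.  The first argument is the
  reference measure, as in \<^const>\<open>KL_divergence\<close>.
\<close>

definition KL :: "'a measure \<Rightarrow> 'a measure \<Rightarrow> ereal" where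
  "KL M N =
     (if absolutely_continuous M N \<and> integrable N (entropy_density (exp 1) M N)
      then ereal (KL_divergence (exp 1) M N) else \<infinity>)"

text \<open>
  The regularization parameter ranges over the extended reals.  Multiplication on \<^typ>\<open>ereal\<close>
  satisfies $0 \cdot \infty = \infty \cdot 0 = 0$ and $\infty \cdot h = \infty$ for $h > 0$, which
  are the conventions needed for the parameter values $0$ and $\infty$.
\<close>

definition sinkhorn ::
    "('a \<times> 'a \<Rightarrow> real) \<Rightarrow> 'a measure \<Rightarrow> ereal \<Rightarrow> 'a measure \<Rightarrow> 'a measure \<Rightarrow> ereal" where
  "sinkhorn c \<nu> \<epsilon> P Q =
     (INF \<gamma> \<in> couplings P Q. expected_cost c \<gamma> + \<epsilon> * KL (P \<Otimes>\<^sub>M \<nu>) \<gamma>)"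

lemma sinkhorn_0: "sinkhorn c \<nu> 0 P Q = OT c P Q"
  by (simp add: sinkhorn_def OT_def)

definition OT_ball ::
    "'a::topological_space set \<Rightarrow> ('a \<times> 'a \<Rightarrow> real) \<Rightarrow> real \<Rightarrow> 'a measure \<Rightarrow> 'a measure set" where
  "OT_ball Z c \<rho> P = {Q \<in> probs_on Z. OT c P Q \<le> ereal \<rho>}"

definition sinkhorn_ball ::
    "'a::topological_space set \<Rightarrow> ('a \<times> 'a \<Rightarrow> real) \<Rightarrow> 'a measure \<Rightarrow> real \<Rightarrow> ereal \<Rightarrow> 'a measure
      \<Rightarrow> 'a measure set" where
  "sinkhorn_ball Z c \<nu> \<rho> \<epsilon> P = {Q \<in> probs_on Z. sinkhorn c \<nu> \<epsilon> P Q \<le> ereal \<rho>}"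

end

theory Submission
  imports Defs
begin

text \<open>Everything rests on one fact, Gibbs' inequality with its equality case: for a coupling
  \<gamma> of P and Q, the divergence of \<gamma> from \<open>P \<Otimes>\<^sub>M \<nu>\<close> is
  nonnegative and vanishes exactly when \<gamma> is that product (\<open>P\<nu>.KL_same\<close>,
  \<open>KL_coupling_pos\<close>). Nonnegativity makes the regularized cost of each fixed coupling
  nondecreasing in \<epsilon>. Hence so is its infimum (\<open>sinkhorn_mono\<close>), and the balls
  shrink as \<epsilon> grows. The optimal transport ball is the case of parameter 0, so both
  inclusions are instances of this monotonicity. At \<epsilon> = \<infinity>, strict positivity
  gives infinite cost to every coupling other than the product. The product has second marginal
  \<nu>, so it couples P and Q only if Q = \<nu>. The discrepancy is therefore the product cost at Q
  = \<nu> and \<infinity> elsewhere (\<open>sinkhorn_infinity\<close>), and comparison with \<rho>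
  settles the last claim.\<close>

context information_space
begin

text \<open>Extends \<open>KL_gt_0\<close>, which is about measures given by a real-valued density,
  to any dominated N: the Radon-Nikodym derivative is finite almost everywhere, so its real part D
  is still a density of N.\<close>

lemma KL_gt_0_ac:
  assumes N: "prob_space N"
    and ac: "absolutely_continuous M N" "sets N = sets M"
    and int: "integrable N (entropy_density b M N)"
    and neq: "N \<noteq> M"
  shows "0 < KL_divergence b M N"
proof -
  interpret N: prob_space N by fact
  define D where "D x = enn2real (RN_deriv M N x)" for x
  have [measurable]: "D \<in> borel_measurable M"
    unfolding D_def by measurable
  have "AE x in M. RN_deriv M N x \<noteq> \<infinity>"
    using N.sigma_finite_measure_axioms ac by (rule RN_deriv_finite)
  then have D: "AE x in M. RN_deriv M N x = ennreal (D x)"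
    by eventually_elim (auto simp: D_def less_top)
  have "N = density M (RN_deriv M N)"
    using ac by (rule density_RN_deriv[symmetric])
  also have "\<dots> = density M D"
    using D by (auto intro!: density_cong)
  finally have N_eq: "N = density M D" .
  have "integrable N (\<lambda>x. log b (D x))"
    using int by (simp add: entropy_density_def comp_def D_def)
  \<comment> \<open>Change of measure: integrating the log-density against N is integrating D log D
    against M, the form in which \<open>KL_gt_0\<close> needs integrability.\<close>
  then have "integrable M (\<lambda>x. D x * log b (D x))"
    unfolding N_eq by (subst (asm) integrable_real_density) (auto simp: D_def)
  then show ?thesis
    using N neq KL_gt_0[of D] unfolding N_eq by (auto simp: D_def)
qed

text \<open>The derivative of M with respect to itself is 1 almost everywhere. This discharges the
  integrability guard in \<open>KL\<close>, without which \<open>KL M M\<close> would be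
  \<infinity>.\<close>

lemma integrable_entropy_density_same: "integrable M (entropy_density b M M)"
proof -
  have "AE x in M. 1 = RN_deriv M M x"
    by (rule RN_deriv_unique) (auto simp: density_1)
  then have "AE x in M. 0 = entropy_density b M M x"
    by eventually_elim (metis comp_apply enn2real_1 entropy_density_def log_one)
  then show ?thesis
    by (subst integrable_cong_AE[where g = "\<lambda>_. 0"]) auto
qed

end

context prob_space
begin

interpretation information_space M "exp 1"
  by unfold_locales simp

lemma KL_same: "KL M M = 0"
  using integrable_entropy_density_same KL_same_eq_0
  by (simp add: KL_def absolutely_continuous_def)

text \<open>If the guard in \<open>KL\<close> fails the value is \<infinity>, which is positive;
  otherwise \<open>KL_gt_0_ac\<close> applies.\<close>

lemma KL_pos:
  assumes "prob_space N" "sets N = sets M" "N \<noteq> M"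
  shows "0 < KL M N"
  using KL_gt_0_ac[of N] assms by (auto simp: KL_def)

end

lemma expected_cost_nonneg: "0 \<le> expected_cost c \<gamma>"
  by (simp add: expected_cost_def)

lemma distr_pair_snd:
  assumes "prob_space M" "prob_space N"
  shows "distr (M \<Otimes>\<^sub>M N) N snd = N"
proof -
  interpret M: prob_space M by fact
  interpret N: prob_space N by fact
  interpret pair_sigma_finite M N ..
  have "distr (M \<Otimes>\<^sub>M N) N snd = distr (N \<Otimes>\<^sub>M M) N fst"
    by (subst distr_pair_swap) (simp add: distr_distr comp_def case_prod_beta)
  then show ?thesis
    by (simp add: M.distr_pair_fst)
qed

lemma product_coupling:
  assumes "prob_space P" "prob_space Q"
  shows "P \<Otimes>\<^sub>M Q \<in> couplings P Q"
  using assms by (simp add: couplings_def prob_space.distr_pair_fst distr_pair_snd prob_space_pair)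

lemma product_coupling_cancel:
  assumes "prob_space P" "prob_space \<nu>" "sets Q = sets \<nu>" "P \<Otimes>\<^sub>M \<nu> \<in> couplings P Q"
  shows "Q = \<nu>"
proof -
  have "Q = distr (P \<Otimes>\<^sub>M \<nu>) Q snd"
    using assms(4) by (simp add: couplings_def)
  \<comment> \<open>The target measure of \<open>distr\<close> matters only through its
    sigma-algebra, so \<nu> may replace Q there.\<close>
  also have "\<dots> = distr (P \<Otimes>\<^sub>M \<nu>) \<nu> snd"
    by (rule distr_cong) (simp_all add: assms(3))
  finally show ?thesis
    using assms(1,2) by (simp add: distr_pair_snd)
qed

context
  fixes P \<nu> Q :: "'a measure"
  assumes prob: "prob_space P" "prob_space \<nu>" and sets_eq: "sets Q = sets \<nu>"
begin

interpretation P\<nu>: prob_space "P \<Otimes>\<^sub>M \<nu>"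
  using prob by (rule prob_space_pair)

lemma KL_coupling_pos:
  assumes "\<gamma> \<in> couplings P Q" "\<gamma> \<noteq> P \<Otimes>\<^sub>M \<nu>"
  shows "0 < KL (P \<Otimes>\<^sub>M \<nu>) \<gamma>"
  using assms sets_pair_measure_cong[OF refl sets_eq, of P]
  by (intro P\<nu>.KL_pos) (auto simp: couplings_def)

lemma KL_coupling_nonneg:
  assumes "\<gamma> \<in> couplings P Q"
  shows "0 \<le> KL (P \<Otimes>\<^sub>M \<nu>) \<gamma>"
  using KL_coupling_pos[OF assms] P\<nu>.KL_same by (cases "\<gamma> = P \<Otimes>\<^sub>M \<nu>") auto

lemma sinkhorn_mono:
  assumes "\<epsilon>\<^sub>1 \<le> \<epsilon>\<^sub>2"
  shows "sinkhorn c \<nu> \<epsilon>\<^sub>1 P Q \<le> sinkhorn c \<nu> \<epsilon>\<^sub>2 P Q"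
  unfolding sinkhorn_def
  by (intro INF_superset_mono order_refl add_mono ereal_mult_right_mono KL_coupling_nonneg assms)

text \<open>The product \<open>\<infinity> * 0\<close> is 0 and \<infinity> times a positive value
  is \<infinity>; the cost, being nonnegative, cannot cancel an infinite penalty.\<close>

lemma sinkhorn_infinity_cost:
  assumes "\<gamma> \<in> couplings P Q"
  shows "expected_cost c \<gamma> + \<infinity> * KL (P \<Otimes>\<^sub>M \<nu>) \<gamma> =
    (if \<gamma> = P \<Otimes>\<^sub>M \<nu> then expected_cost c \<gamma> else \<infinity>)"
  using KL_coupling_pos[OF assms] expected_cost_nonneg[of c \<gamma>] by (auto simp: P\<nu>.KL_same)

lemma sinkhorn_infinity:
  "sinkhorn c \<nu> \<infinity> P Q = (if Q = \<nu> then expected_cost c (P \<Otimes>\<^sub>M \<nu>) else \<infinity>)"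
proof -
  have "sinkhorn c \<nu> \<infinity> P Q =
      (INF \<gamma> \<in> couplings P Q. if \<gamma> = P \<Otimes>\<^sub>M \<nu> then expected_cost c \<gamma> else \<infinity>)"
    unfolding sinkhorn_def by (intro INF_cong refl sinkhorn_infinity_cost)
  also have "\<dots> = (if Q = \<nu> then expected_cost c (P \<Otimes>\<^sub>M \<nu>) else \<infinity>)"
  proof (cases "Q = \<nu>")
    case True
    then have "P \<Otimes>\<^sub>M \<nu> \<in> couplings P Q"
      using prob by (simp add: product_coupling)
    then have "(INF \<gamma> \<in> couplings P Q. if \<gamma> = P \<Otimes>\<^sub>M \<nu> then expected_cost c \<gamma> else \<infinity>)
        = expected_cost c (P \<Otimes>\<^sub>M \<nu>)"
      by (intro antisym INF_greatest) (rule INF_lower2, assumption, simp_all)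
    with True show ?thesis
      by simp
  next
    case False
    then have "P \<Otimes>\<^sub>M \<nu> \<notin> couplings P Q"
      using product_coupling_cancel prob sets_eq by blast
    \<comment> \<open>No coupling is the product, so every term of the infimum is
      \<infinity>.\<close>
    with False show ?thesis
      by (auto intro!: antisym INF_greatest simp: top_ereal_def[symmetric])
  qed
  finally show ?thesis .
qed

end

lemma expected_cost_le_iff:
  assumes "0 \<le> \<rho>"
  shows "expected_cost c \<gamma> \<le> ereal \<rho> \<longleftrightarrow> (\<integral>\<^sup>+ z. ennreal (c z) \<partial>\<gamma>) \<le> ennreal \<rho>"
  using assms by (simp add: expected_cost_def less_eq_ennreal.rep_eq enn2ereal_ennreal)

lemma OT_ball_eq_sinkhorn_ball: "OT_ball Z c \<rho> P = sinkhorn_ball Z c \<nu> \<rho> 0 P"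
  by (simp add: OT_ball_def sinkhorn_ball_def sinkhorn_0)

theorem proposition1:
  fixes Z :: "'a::second_countable_topology set"
    and c :: "'a \<times> 'a \<Rightarrow> real"
    and P \<nu> :: "'a measure"
    and \<rho> :: real
  assumes "Z \<in> sets borel"
    and "transport_cost Z c"
    and "\<nu> \<in> probs_on Z"
    and "P \<in> probs_on Z"
    and "0 \<le> \<rho>"
  shows "(\<forall>\<epsilon>::ereal. 0 \<le> \<epsilon> \<longrightarrow> sinkhorn_ball Z c \<nu> \<rho> \<epsilon> P \<subseteq> OT_ball Z c \<rho> P) \<and>
    (\<forall>\<epsilon>\<^sub>1 \<epsilon>\<^sub>2 :: ereal. 0 \<le> \<epsilon>\<^sub>1 \<longrightarrow> \<epsilon>\<^sub>1 \<le> \<epsilon>\<^sub>2 \<longrightarrow>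
       sinkhorn_ball Z c \<nu> \<rho> \<epsilon>\<^sub>2 P \<subseteq> sinkhorn_ball Z c \<nu> \<rho> \<epsilon>\<^sub>1 P) \<and>
    (if (\<integral>\<^sup>+ z. ennreal (c z) \<partial>(P \<Otimes>\<^sub>M \<nu>)) \<le> ennreal \<rho>
     then sinkhorn_ball Z c \<nu> \<rho> \<infinity> P = {\<nu>}
     else sinkhorn_ball Z c \<nu> \<rho> \<infinity> P = {})"
proof -
  have P: "prob_space P" and \<nu>: "prob_space \<nu>"
    using assms by (simp_all add: mem_probs_on_iff)
  \<comment> \<open>All members of \<open>probs_on Z\<close> share the Borel sigma-algebra of Z, so
    the coupling lemmas apply to each Q in a ball.\<close>
  have sets_eq: "sets Q = sets \<nu>" if "Q \<in> probs_on Z" for Q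
    using that assms by (simp add: mem_probs_on_iff)
  have mono: "sinkhorn_ball Z c \<nu> \<rho> \<epsilon>\<^sub>2 P \<subseteq> sinkhorn_ball Z c \<nu> \<rho> \<epsilon>\<^sub>1 P" if "\<epsilon>\<^sub>1 \<le> \<epsilon>\<^sub>2" for \<epsilon>\<^sub>1 \<epsilon>\<^sub>2
    using sinkhorn_mono[OF P \<nu> sets_eq that, of _ c] by (auto simp: sinkhorn_ball_def intro: order_trans)
  have "Q \<in> sinkhorn_ball Z c \<nu> \<rho> \<infinity> P \<longleftrightarrow>
      Q = \<nu> \<and> (\<integral>\<^sup>+ z. ennreal (c z) \<partial>(P \<Otimes>\<^sub>M \<nu>)) \<le> ennreal \<rho>" for Q
    using assms sinkhorn_infinity[OF P \<nu> sets_eq, of Q c]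
    by (auto simp: sinkhorn_ball_def expected_cost_le_iff split: if_splits)
  then show ?thesis
    using mono by (auto simp: OT_ball_eq_sinkhorn_ball[of Z c \<rho> P \<nu>])
qed

end
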